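(* Let $G$ be a Lie group with Lie algebra $\mathfrak g$. The mappings $$Emb_1:G\circledS\mathfrak g^*\hookrightarrow{}^{1}TT^*G,\ (g,\mu)\mapsto(g,\mu,0,0),\qquad Emb_2:G\circledS\mathfrak g^*\hookrightarrow{}^{1}TT^*G,\ (g,\nu)\mapsto(g,0,0,\nu)$$ define, respectively, a Lagrangian embedding and a symplectic embedding of $G\circledS\mathfrak g^*$ (with its canonical symplectic form $\Omega_{G\circledS\mathfrak g^*}$) into Tulczyjew's symplectic space $({}^{1}TT^*G,\Omega_{{}^{1}TT^*G})$.
   Context: Conventions. $G$ is a (finite-dimensional) Lie group with identity $e$, $\mathfrak g=T_eG$, $\mathfrak g^*$ its dual. $R_g$ is right translation. $Ad_g$ is the tangent map at $e$ of $h\mapsto g^{-1}hg$; the Lie bracket is $[\xi,\eta]=ad_\xi\eta=\frac{d}{dt}|_{t=0}Ad_{\exp(t\xi)}\eta$ (the bracket of right invariant vector fields). $\langle ad^*_\xi\mu,\eta\rangle=\langle\mu,[\xi,\eta]\rangle$. $G\circledS\mathfrak g^*$ is $G\times\mathfrak g^*$ as a manifold; with $X_{(\xi,\nu)}(g,\mu)=(T_eR_g\xi,\nu+ad^*_\xi\mu)$ for $(\xi,\nu)\in\mathfrak g\times\mathfrak g^*$, its canonical symplectic form is determined by $$\Omega_{G\circledS\mathfrak g^*}(X_{(\xi,\nu)},X_{(\eta,\lambda)})(g,\mu)=\langle\nu,\eta\rangle-\langle\lambda,\xi\rangle+\langle\mu,[\xi,\eta]\rangle.$$ ${}^{1}TT^*G=(G\circledS\mathfrak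 g_1^* )\circledS(\mathfrak g_2\circledS\mathfrak g_3^* )$ is $G\times\mathfrak g^*\times\mathfrak g\times\mathfrak g^*\ni(g,\mu,\xi,\nu)$ as a manifold. For $(\xi_2,\nu_2,\xi_3,\nu_3)\in\mathfrak g\times\mathfrak g^*\times\mathfrak g\times\mathfrak g^*$ let $$X_{(\xi_2,\nu_2,\xi_3,\nu_3)}(g,\mu,\xi,\nu)=(T_eR_g\xi_2,\ \nu_2+ad^*_{\xi_2}\mu,\ \xi_3+[\xi,\xi_2],\ \nu_3+ad^*_{\xi_2}\nu-ad^*_\xi\nu_2).$$ The symplectic form is determined by $$\Omega_{{}^{1}TT^*G}(X_{(\xi_2,\nu_2,\xi_3,\nu_3)},X_{(\bar\xi_2,\bar\nu_2,\bar\xi_3,\bar\nu_3)})=\langle\nu_3,\bar\xi_2\rangle+\langle\nu_2,\bar\xi_3\rangle-\langle\bar\nu_2,\xi_3\rangle-\langle\bar\nu_3,\xi_2\rangle+\langle\nu,[\xi_2,\bar\xi_2]\rangle+\langle\mu,[\xi_3,\bar\xi_2]+[\xi_2,\bar\xi_3]+[\xi,[\xi_2,\bar\xi_2]]\rangle.$$ *)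

theory Defs
  imports "HOL-Analysis.Analysis" "HOL-Algebra.Group"
begin

section \<open>Smooth maps between open subsets of finite-dimensional normed spaces\<close>

text \<open>
  Continuity and differentiability of all iterated directional derivatives. On an open
  subset \<open>S\<close> of a finite-dimensional space this is the usual class \<open>C\<^sup>k\<close>.
\<close>

primrec Ck_on :: "nat \<Rightarrow> 'a::real_normed_vector set \<Rightarrow> ('a \<Rightarrow> 'b::real_normed_vector) \<Rightarrow> bool" where
  "Ck_on 0 S f \<longleftrightarrow> continuous_on S f"
| "Ck_on (Suc k) S f \<longleftrightarrow>
     (\<forall>x\<in>S. f differentiable (at x)) \<and>
     (\<forall>v. Ck_on k S (\<lambda>x. frechet_derivative f (at x) v))"

definition smooth_on :: "'a::real_normed_vector set \<Rightarrow> ('a \<Rightarrow> 'b::real_normed_vector) \<Rightarrow> bool" where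
  "smooth_on S f \<longleftrightarrow> (\<forall>k. Ck_on k S f)"

section \<open>Manifolds\<close>

datatype ('p, 'e) chart = Chart (chart_dom: "'p set") (chart_map: "'p \<Rightarrow> 'e")

definition chart_inv :: "('p, 'e) chart \<Rightarrow> 'e \<Rightarrow> 'p" where
  "chart_inv c = inv_into (chart_dom c) (chart_map c)"

text \<open>
  A manifold modelled on the vector space \<open>'e\<close> is given by a smooth atlas indexed by the points,
  the chart with index \<open>p\<close> being a chart around \<open>p\<close>. (Every smooth atlas yields such a family by
  choosing a chart around each point.) The tangent space at \<open>p\<close> is the whole model space \<open>'e\<close>, an
  element of it being the coordinate vector, in the chart with index \<open>p\<close>, of a tangent vector.
\<close>

type_synonym ('p, 'e) charts = "'p \<Rightarrow> ('p, 'e) chart"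

definition smooth_manifold ::
  "('p::{t2_space,second_countable_topology}, 'e::real_normed_vector) charts \<Rightarrow> bool" where
  "smooth_manifold M \<longleftrightarrow>
     (\<exists>B::'e set. finite B \<and> span B = UNIV) \<and>
     (\<forall>p. p \<in> chart_dom (M p) \<and>
          open (chart_dom (M p)) \<and>
          open (chart_map (M p) ` chart_dom (M p)) \<and>
          homeomorphism (chart_dom (M p)) (chart_map (M p) ` chart_dom (M p))
            (chart_map (M p)) (chart_inv (M p))) \<and>
     (\<forall>p q. smooth_on (chart_map (M p) ` (chart_dom (M p) \<inter> chart_dom (M q)))
              (chart_map (M q) \<circ> chart_inv (M p)))"

definition vector_charts :: "('e, 'e) charts" where
  "vector_charts = (\<lambda>v. Chart UNIV id)"

definition prod_charts ::
  "('p, 'e) charts \<Rightarrow> ('q, 'f) charts \<Rightarrow> ('p \<times> 'q, 'e \<times> 'f) charts" (infixr "\<times>\<^sub>M" 80) where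
  "M \<times>\<^sub>M N = (\<lambda>(p, q). Chart (chart_dom (M p) \<times> chart_dom (N q))
                            (map_prod (chart_map (M p)) (chart_map (N q))))"

definition smooth_map ::
  "('p::topological_space, 'e::real_normed_vector) charts \<Rightarrow>
   ('q::topological_space, 'f::real_normed_vector) charts \<Rightarrow> ('p \<Rightarrow> 'q) \<Rightarrow> bool" where
  "smooth_map M N f \<longleftrightarrow>
     continuous_on UNIV f \<and>
     (\<forall>p q. smooth_on (chart_map (M p) ` (chart_dom (M p) \<inter> f -` chart_dom (N q)))
              (chart_map (N q) \<circ> f \<circ> chart_inv (M p)))"

text \<open>The tangent map \<open>T\<^sub>p M \<rightarrow> T\<^bsub>f p\<^esub> N\<close> of \<open>f\<close> at \<open>p\<close>.\<close>

definition tangent_map ::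
  "('p, 'e::real_normed_vector) charts \<Rightarrow> ('q, 'f::real_normed_vector) charts \<Rightarrow>
   ('p \<Rightarrow> 'q) \<Rightarrow> 'p \<Rightarrow> 'e \<Rightarrow> 'f" where
  "tangent_map M N f p =
     frechet_derivative (chart_map (N (f p)) \<circ> f \<circ> chart_inv (M p)) (at (chart_map (M p) p))"

definition smooth_embedding ::
  "('p::topological_space, 'e::real_normed_vector) charts \<Rightarrow>
   ('q::topological_space, 'f::real_normed_vector) charts \<Rightarrow> ('p \<Rightarrow> 'q) \<Rightarrow> bool" where
  "smooth_embedding M N f \<longleftrightarrow>
     smooth_map M N f \<and>
     (\<forall>p. inj (tangent_map M N f p)) \<and>
     embedding_map euclidean euclidean f"

section \<open>Lagrangian and symplectic embeddings\<close>

type_synonym ('p, 'e) two_form = "'p \<Rightarrow> 'e \<Rightarrow> 'e \<Rightarrow> real"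

definition lagrangian_subspace :: "('f::real_vector \<Rightarrow> 'f \<Rightarrow> real) \<Rightarrow> 'f set \<Rightarrow> bool" where
  "lagrangian_subspace \<omega> W \<longleftrightarrow>
     subspace W \<and> (\<forall>v\<in>W. \<forall>w\<in>W. \<omega> v w = 0) \<and> 2 * dim W = dim (UNIV :: 'f set)"

definition lagrangian_embedding ::
  "('p::topological_space, 'e::real_normed_vector) charts \<Rightarrow>
   ('q::topological_space, 'f::real_normed_vector) charts \<Rightarrow> ('q, 'f) two_form \<Rightarrow>
   ('p \<Rightarrow> 'q) \<Rightarrow> bool" where
  "lagrangian_embedding M N \<Omega> f \<longleftrightarrow>
     smooth_embedding M N f \<and>
     (\<forall>p. lagrangian_subspace (\<Omega> (f p)) (range (tangent_map M N f p)))"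

definition pullback_form ::
  "('p, 'e::real_normed_vector) charts \<Rightarrow> ('q, 'f::real_normed_vector) charts \<Rightarrow>
   ('p \<Rightarrow> 'q) \<Rightarrow> ('q, 'f) two_form \<Rightarrow> ('p, 'e) two_form" where
  "pullback_form M N f \<Omega> = (\<lambda>p v w. \<Omega> (f p) (tangent_map M N f p v) (tangent_map M N f p w))"

definition symplectic_embedding ::
  "('p::topological_space, 'e::real_normed_vector) charts \<Rightarrow> ('p, 'e) two_form \<Rightarrow>
   ('q::topological_space, 'f::real_normed_vector) charts \<Rightarrow> ('q, 'f) two_form \<Rightarrow>
   ('p \<Rightarrow> 'q) \<Rightarrow> bool" where
  "symplectic_embedding M \<Omega>\<^sub>M N \<Omega>\<^sub>N f \<longleftrightarrow>
     smooth_embedding M N f \<and> pullback_form M N f \<Omega>\<^sub>N = \<Omega>\<^sub>M"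

section \<open>Lie groups\<close>

record ('g, 'e) lie_structure = "'g monoid" +
  charts :: "('g, 'e) charts"

definition lie_group ::
  "('g::{t2_space,second_countable_topology}, 'e::real_normed_vector) lie_structure \<Rightarrow> bool" where
  "lie_group G \<longleftrightarrow>
     group G \<and> carrier G = UNIV \<and>
     smooth_manifold (charts G) \<and>
     smooth_map (charts G \<times>\<^sub>M charts G) (charts G) (\<lambda>(g, h). g \<otimes>\<^bsub>G\<^esub> h) \<and>
     smooth_map (charts G) (charts G) (\<lambda>g. inv\<^bsub>G\<^esub> g)"

text \<open>
  The Lie algebra is the tangent space at the identity, that is, the model space \<open>'e\<close>; its dual
  consists of the (automatically bounded) linear functionals on \<open>'e\<close>.
\<close>

type_synonym 'e dual = "'e \<Rightarrow>\<^sub>L real"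

definition T_R :: "('g, 'e::real_normed_vector) lie_structure \<Rightarrow> 'g \<Rightarrow> 'e \<Rightarrow> 'e" where
  "T_R G g = tangent_map (charts G) (charts G) (\<lambda>h. h \<otimes>\<^bsub>G\<^esub> g) \<one>\<^bsub>G\<^esub>"

text \<open>Note the convention \<open>h \<mapsto> g\<inverse> h g\<close>, under which the bracket below is that of right
  invariant vector fields.\<close>

definition Ad :: "('g, 'e::real_normed_vector) lie_structure \<Rightarrow> 'g \<Rightarrow> 'e \<Rightarrow> 'e" where
  "Ad G g = tangent_map (charts G) (charts G) (\<lambda>h. inv\<^bsub>G\<^esub> g \<otimes>\<^bsub>G\<^esub> h \<otimes>\<^bsub>G\<^esub> g) \<one>\<^bsub>G\<^esub>"

definition one_parameter_subgroup ::
  "('g::topological_space, 'e::real_normed_vector) lie_structure \<Rightarrow> (real \<Rightarrow> 'g) \<Rightarrow> bool" where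
  "one_parameter_subgroup G \<gamma> \<longleftrightarrow>
     smooth_map vector_charts (charts G) \<gamma> \<and> (\<forall>s t. \<gamma> (s + t) = \<gamma> s \<otimes>\<^bsub>G\<^esub> \<gamma> t)"

definition lie_exp ::
  "('g::topological_space, 'e::real_normed_vector) lie_structure \<Rightarrow> 'e \<Rightarrow> 'g" where
  "lie_exp G \<xi> =
     (THE \<gamma>. one_parameter_subgroup G \<gamma> \<and> tangent_map vector_charts (charts G) \<gamma> 0 1 = \<xi>) 1"

definition bracket ::
  "('g::topological_space, 'e::real_normed_vector) lie_structure \<Rightarrow> 'e \<Rightarrow> 'e \<Rightarrow> 'e" where
  "bracket G \<xi> \<eta> = vector_derivative (\<lambda>t. Ad G (lie_exp G (t *\<^sub>R \<xi>)) \<eta>) (at 0)"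

definition ad_star ::
  "('g::topological_space, 'e::real_normed_vector) lie_structure \<Rightarrow> 'e \<Rightarrow> 'e dual \<Rightarrow> 'e dual" where
  "ad_star G \<xi> \<mu> = Blinfun (\<lambda>\<eta>. blinfun_apply \<mu> (bracket G \<xi> \<eta>))"

section \<open>The symplectic spaces \<open>G \<circledS> \<gg>*\<close> and \<open>\<^sup>1TT*G\<close>\<close>

definition GS_charts ::
  "('g, 'e::real_normed_vector) lie_structure \<Rightarrow> ('g \<times> 'e dual, 'e \<times> 'e dual) charts" where
  "GS_charts G = charts G \<times>\<^sub>M vector_charts"

definition GS_field ::
  "('g::topological_space, 'e::real_normed_vector) lie_structure \<Rightarrow>
   'e \<times> 'e dual \<Rightarrow> 'g \<times> 'e dual \<Rightarrow> 'e \<times> 'e dual" where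
  "GS_field G = (\<lambda>(\<xi>, \<nu>) (g, \<mu>). (T_R G g \<xi>, \<nu> + ad_star G \<xi> \<mu>))"

definition GS_form ::
  "('g::topological_space, 'e::real_normed_vector) lie_structure \<Rightarrow>
   ('g \<times> 'e dual, 'e \<times> 'e dual) two_form" where
  "GS_form G = (\<lambda>(g, \<mu>) v w. THE r. \<exists>\<xi> \<nu> \<eta> \<kappa>.
     v = GS_field G (\<xi>, \<nu>) (g, \<mu>) \<and>
     w = GS_field G (\<eta>, \<kappa>) (g, \<mu>) \<and>
     r = blinfun_apply \<nu> \<eta> - blinfun_apply \<kappa> \<xi> + blinfun_apply \<mu> (bracket G \<xi> \<eta>))"

definition TTG_charts ::
  "('g, 'e::real_normed_vector) lie_structure \<Rightarrow>
   ('g \<times> 'e dual \<times> 'e \<times> 'e dual, 'e \<times> 'e dual \<times> 'e \<times> 'e dual) charts" where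
  "TTG_charts G = charts G \<times>\<^sub>M vector_charts \<times>\<^sub>M vector_charts \<times>\<^sub>M vector_charts"

definition TTG_field ::
  "('g::topological_space, 'e::real_normed_vector) lie_structure \<Rightarrow>
   'e \<times> 'e dual \<times> 'e \<times> 'e dual \<Rightarrow> 'g \<times> 'e dual \<times> 'e \<times> 'e dual \<Rightarrow>
   'e \<times> 'e dual \<times> 'e \<times> 'e dual" where
  "TTG_field G = (\<lambda>(\<xi>\<^sub>2, \<nu>\<^sub>2, \<xi>\<^sub>3, \<nu>\<^sub>3) (g, \<mu>, \<xi>, \<nu>).
     (T_R G g \<xi>\<^sub>2,
      \<nu>\<^sub>2 + ad_star G \<xi>\<^sub>2 \<mu>,
      \<xi>\<^sub>3 + bracket G \<xi> \<xi>\<^sub>2,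
      \<nu>\<^sub>3 + ad_star G \<xi>\<^sub>2 \<nu> - ad_star G \<xi> \<nu>\<^sub>2))"

definition TTG_form ::
  "('g::topological_space, 'e::real_normed_vector) lie_structure \<Rightarrow>
   ('g \<times> 'e dual \<times> 'e \<times> 'e dual, 'e \<times> 'e dual \<times> 'e \<times> 'e dual) two_form" where
  "TTG_form G = (\<lambda>(g, \<mu>, \<xi>, \<nu>) v w. THE r. \<exists>\<xi>\<^sub>2 \<nu>\<^sub>2 \<xi>\<^sub>3 \<nu>\<^sub>3 \<eta>\<^sub>2 \<kappa>\<^sub>2 \<eta>\<^sub>3 \<kappa>\<^sub>3.
     v = TTG_field G (\<xi>\<^sub>2, \<nu>\<^sub>2, \<xi>\<^sub>3, \<nu>\<^sub>3) (g, \<mu>, \<xi>, \<nu>) \<and>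
     w = TTG_field G (\<eta>\<^sub>2, \<kappa>\<^sub>2, \<eta>\<^sub>3, \<kappa>\<^sub>3) (g, \<mu>, \<xi>, \<nu>) \<and>
     r = blinfun_apply \<nu>\<^sub>3 \<eta>\<^sub>2 + blinfun_apply \<nu>\<^sub>2 \<eta>\<^sub>3
         - blinfun_apply \<kappa>\<^sub>2 \<xi>\<^sub>3 - blinfun_apply \<kappa>\<^sub>3 \<xi>\<^sub>2
         + blinfun_apply \<nu> (bracket G \<xi>\<^sub>2 \<eta>\<^sub>2)
         + blinfun_apply \<mu> (bracket G \<xi>\<^sub>3 \<eta>\<^sub>2 + bracket G \<xi>\<^sub>2 \<eta>\<^sub>3
             + bracket G \<xi> (bracket G \<xi>\<^sub>2 \<eta>\<^sub>2)))"

definition Emb\<^sub>1 :: "'g \<times> 'e dual \<Rightarrow> 'g \<times> 'e::real_normed_vector dual \<times> 'e \<times> 'e dual" where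
  "Emb\<^sub>1 = (\<lambda>(g, \<mu>). (g, \<mu>, 0, 0))"

definition Emb\<^sub>2 :: "'g \<times> 'e dual \<Rightarrow> 'g \<times> 'e::real_normed_vector dual \<times> 'e \<times> 'e dual" where
  "Emb\<^sub>2 = (\<lambda>(g, \<nu>). (g, 0, 0, \<nu>))"

end

theory Submission
  imports Defs
begin

text \<open>
  Right translations have invertible tangent maps and the bracket vanishes when one argument does,
  so every tangent vector at a point in the image of either embedding extends uniquely to a field
  \<open>X\<close>, and the forms may be evaluated on these fields. In trivialised coordinates both
  embeddings are \<open>id \<times> J\<close> with \<open>J\<close> linear and split injective, hence so are their tangent
  maps. On the image of the first, all terms of the form vanish, and the image has half the
  dimension; on the image of the second, only the terms of the canonical form of
  \<open>G \<circledS> \<gg>*\<close> survive.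
\<close>

section \<open>Differential calculus\<close>

text \<open>Chart expressions agree with explicit formulas only on the image of a chart domain. As
  that set is open, agreement there forces equal derivatives at its points, and the induction passes
  to all iterated derivatives.\<close>

lemma Ck_on_cong:
  assumes "open S" "\<And>x. x \<in> S \<Longrightarrow> f x = g x" "Ck_on k S f"
  shows "Ck_on k S g"
  using assms(2,3)
proof (induction k arbitrary: f g)
  case 0
  then show ?case
    using continuous_on_cong[of S S f g] by simp
next
  case (Suc k)
  have der: "(g has_derivative frechet_derivative f (at x)) (at x)" if "x \<in> S" for x
  proof (rule has_derivative_transform_within_open[OF _ assms(1) that])
    show "(f has_derivative frechet_derivative f (at x)) (at x)"
      using Suc.prems(2) that by (simp add: frechet_derivative_works)
  qed (rule Suc.prems(1))
  then have "g differentiable (at x)" if "x \<in> S" for x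
    using that by (auto simp: differentiable_def)
  moreover have "Ck_on k S (\<lambda>x. frechet_derivative g (at x) v)" for v
    by (rule Suc.IH[of "\<lambda>x. frechet_derivative f (at x) v"]) (use frechet_derivative_at[OF der] Suc.prems(2) in auto)
  ultimately show ?case
    by simp
qed

text \<open>For linear \<open>P\<close>, the derivative of \<open>f\<close> after \<open>P\<close>
  along \<open>v\<close> is the derivative of \<open>f\<close> along \<open>P v\<close>, composed
  with \<open>P\<close>. It has the same form again, so the induction over arbitrary
  \<open>f\<close> closes.\<close>

lemma Ck_on_compose_bounded_linear:
  assumes "bounded_linear P" "open T" "P ` T \<subseteq> S" "Ck_on k S f"
  shows "Ck_on k T (\<lambda>x. f (P x))"
  using assms(4)
proof (induction k arbitrary: f)
  case 0
  have "continuous_on T P"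
    using assms(1) by (simp add: linear_continuous_on)
  with 0 show ?case
    using continuous_on_compose2[of S f T P] assms(3) by simp
next
  case (Suc k)
  have der: "((\<lambda>x. f (P x)) has_derivative (\<lambda>v. frechet_derivative f (at (P x)) (P v))) (at x)"
    if "x \<in> T" for x
  proof -
    have "(f has_derivative frechet_derivative f (at (P x))) (at (P x))"
      using Suc.prems that assms(3) by (auto simp: frechet_derivative_works[symmetric])
    from diff_chain_at[OF bounded_linear_imp_has_derivative[OF assms(1)] this]
    show ?thesis
      by (simp add: o_def)
  qed
  have "Ck_on k T (\<lambda>x. frechet_derivative (\<lambda>x. f (P x)) (at x) v)" for v
    by (rule Ck_on_cong[OF assms(2) _ Suc.IH[of "\<lambda>y. frechet_derivative f (at y) (P v)"]])
      (use Suc.prems frechet_derivative_at[OF der] in \<open>auto simp: fun_eq_iff\<close>)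
  with der show ?case
    by (auto simp: differentiable_def)
qed

lemma bounded_linear_compose_Ck_on:
  assumes "bounded_linear L" "open S" "Ck_on k S f"
  shows "Ck_on k S (\<lambda>x. L (f x))"
  using assms(3)
proof (induction k arbitrary: f)
  case 0
  then show ?case
    using assms(1) by (simp add: bounded_linear.continuous_on)
next
  case (Suc k)
  have der: "((\<lambda>x. L (f x)) has_derivative (\<lambda>v. L (frechet_derivative f (at x) v))) (at x)"
    if "x \<in> S" for x
    using Suc.prems that
    by (auto simp: frechet_derivative_works intro!: bounded_linear.has_derivative[OF assms(1)])
  have "Ck_on k S (\<lambda>x. frechet_derivative (\<lambda>x. L (f x)) (at x) v)" for v
    by (rule Ck_on_cong[OF assms(2) _ Suc.IH[of "\<lambda>x. frechet_derivative f (at x) v"]])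
      (use Suc.prems frechet_derivative_at[OF der] in \<open>auto simp: fun_eq_iff\<close>)
  with der show ?case
    by (auto simp: differentiable_def)
qed

lemma Ck_on_add:
  assumes "open S" "Ck_on k S f" "Ck_on k S g"
  shows "Ck_on k S (\<lambda>x. f x + g x)"
  using assms(2,3)
proof (induction k arbitrary: f g)
  case 0
  then show ?case
    by (simp add: continuous_on_add)
next
  case (Suc k)
  have der: "((\<lambda>x. f x + g x) has_derivative
      (\<lambda>v. frechet_derivative f (at x) v + frechet_derivative g (at x) v)) (at x)"
    if "x \<in> S" for x
    using Suc.prems that by (auto simp: frechet_derivative_works intro!: has_derivative_add)
  have "Ck_on k S (\<lambda>x. frechet_derivative (\<lambda>x. f x + g x) (at x) v)" for v
    by (rule Ck_on_cong[OF assms(1) _ Suc.IH[of "\<lambda>x. frechet_derivative f (at x) v"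
            "\<lambda>x. frechet_derivative g (at x) v"]])
      (use Suc.prems frechet_derivative_at[OF der] in \<open>auto simp: fun_eq_iff\<close>)
  with der show ?case
    by (auto simp: differentiable_def)
qed

lemma Ck_on_const: "Ck_on k S (\<lambda>x. c)"
proof (induction k arbitrary: c)
  case (Suc k)
  have "frechet_derivative (\<lambda>x. c) (at x) = (\<lambda>v. 0)" for x :: 'a
    using frechet_derivative_at[OF has_derivative_const] by metis
  with Suc show ?case
    by simp
qed simp

lemma Ck_on_bounded_linear:
  assumes "bounded_linear L"
  shows "Ck_on k S L"
proof (cases k)
  case 0
  then show ?thesis
    using assms by (simp add: linear_continuous_on)
next
  case (Suc j)
  have der: "(L has_derivative L) (at x)" for x
    using assms by (rule bounded_linear_imp_has_derivative)
  have "frechet_derivative L (at x) = L" for x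
    using frechet_derivative_at[OF der] by simp
  with der Suc show ?thesis
    by (auto simp: differentiable_def Ck_on_const)
qed

section \<open>Charts and tangent maps\<close>

text \<open>This guards \<open>tangent_map\<close>: \<open>frechet_derivative\<close> is an
  arbitrary choice unless the coordinate expression is differentiable.\<close>

definition diff_at ::
  "('p, 'e::real_normed_vector) charts \<Rightarrow> ('q, 'f::real_normed_vector) charts \<Rightarrow>
   ('p \<Rightarrow> 'q) \<Rightarrow> 'p \<Rightarrow> bool" where
  "diff_at M N f p \<longleftrightarrow>
     chart_map (N (f p)) \<circ> f \<circ> chart_inv (M p) differentiable at (chart_map (M p) p)"

lemma diff_at_has_derivative:
  assumes "diff_at M N f p"
  shows "(chart_map (N (f p)) \<circ> f \<circ> chart_inv (M p) has_derivative tangent_map M N f p)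
           (at (chart_map (M p) p))"
  using assms unfolding diff_at_def tangent_map_def by (simp add: frechet_derivative_works)

lemma linear_tangent_map: "diff_at M N f p \<Longrightarrow> linear (tangent_map M N f p)"
  by (rule has_derivative_linear[OF diff_at_has_derivative])

lemma smooth_manifoldD:
  assumes "smooth_manifold M"
  shows "p \<in> chart_dom (M p)" "open (chart_dom (M p))"
    "homeomorphism (chart_dom (M p)) (chart_map (M p) ` chart_dom (M p))
       (chart_map (M p)) (chart_inv (M p))"
    "open (chart_map (M p) ` chart_dom (M p))"
    "smooth_on (chart_map (M p) ` (chart_dom (M p) \<inter> chart_dom (M q)))
              (chart_map (M q) \<circ> chart_inv (M p))"
    "x \<in> chart_dom (M p) \<Longrightarrow> chart_inv (M p) (chart_map (M p) x) = x"
    "inj_on (chart_map (M p)) (chart_dom (M p))"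
proof -
  show hom: "homeomorphism (chart_dom (M p)) (chart_map (M p) ` chart_dom (M p))
       (chart_map (M p)) (chart_inv (M p))"
    using assms unfolding smooth_manifold_def by blast
  then have inv: "chart_inv (M p) (chart_map (M p) x) = x" if "x \<in> chart_dom (M p)" for x
    using that unfolding homeomorphism_def by blast
  then show "x \<in> chart_dom (M p) \<Longrightarrow> chart_inv (M p) (chart_map (M p) x) = x" .
  show "inj_on (chart_map (M p)) (chart_dom (M p))"
    using inv by (metis inj_onI)
qed (use assms in \<open>simp_all add: smooth_manifold_def\<close>)

lemma open_chart_image:
  assumes "smooth_manifold M" "open U"
  shows "open (chart_map (M p) ` (chart_dom (M p) \<inter> U))"
  using homeomorphism_imp_open_map[OF smooth_manifoldD(3)[OF assms(1)], of p "chart_dom (M p) \<inter> U"]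
    smooth_manifoldD(4)[OF assms(1), of p] assms(2)
  by (simp add: openin_open_Int openin_open_eq)

text \<open>The memberships are separate hypotheses so that the lemma applies directly to
  multiplication, whose source carries product charts.\<close>

lemma smooth_map_imp_diff_at:
  assumes "smooth_map M N f" "p \<in> chart_dom (M p)" "f p \<in> chart_dom (N (f p))"
  shows "diff_at M N f p"
proof -
  have "Ck_on (Suc 0) (chart_map (M p) ` (chart_dom (M p) \<inter> f -` chart_dom (N (f p))))
          (chart_map (N (f p)) \<circ> f \<circ> chart_inv (M p))"
    using assms(1) unfolding smooth_map_def smooth_on_def by blast
  then show ?thesis
    using assms(2,3) unfolding diff_at_def Ck_on.simps(2) by blast
qed

text \<open>The coordinate expression contains \<open>chart_inv\<close>, which is meaningful only on
  the chart image. A derivative is local, so any \<open>F\<close> that represents \<open>f\<close>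
  in the two charts near \<open>p\<close> computes the tangent map.\<close>

lemma tangent_map_unique:
  assumes "smooth_manifold M" "open U" "p \<in> U"
    and "(F has_derivative F') (at (chart_map (M p) p))"
    and "\<And>x. x \<in> U \<Longrightarrow> x \<in> chart_dom (M p) \<Longrightarrow> F (chart_map (M p) x) = chart_map (N (f p)) (f x)"
  shows "diff_at M N f p" "tangent_map M N f p = F'"
proof -
  note M = smooth_manifoldD[OF assms(1)]
  let ?V = "chart_map (M p) ` (chart_dom (M p) \<inter> U)"
  have "(chart_map (N (f p)) \<circ> f \<circ> chart_inv (M p) has_derivative F') (at (chart_map (M p) p))"
    by (rule has_derivative_transform_within_open[OF assms(4) open_chart_image[OF assms(1,2)]])
      (use M(1,6) assms(3,5) in auto)
  then show "diff_at M N f p" "tangent_map M N f p = F'"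
    unfolding diff_at_def tangent_map_def differentiable_def
    using frechet_derivative_at by metis+
qed

lemma tangent_map_id:
  assumes "smooth_manifold M"
  shows "tangent_map M M (\<lambda>x. x) p = id"
  by (rule tangent_map_unique(2)[OF assms open_UNIV]) (auto simp: id_def)

lemma tangent_map_compose:
  assumes "smooth_manifold M" "smooth_manifold N" "continuous_on UNIV f"
    and "diff_at M N f p" "diff_at N P g (f p)"
  shows "diff_at M P (\<lambda>x. g (f x)) p"
    "tangent_map M P (\<lambda>x. g (f x)) p = tangent_map N P g (f p) \<circ> tangent_map M N f p"
proof -
  note M = smooth_manifoldD[OF assms(1)] and N = smooth_manifoldD[OF assms(2)]
  let ?F = "chart_map (N (f p)) \<circ> f \<circ> chart_inv (M p)"
  let ?G = "chart_map (P (g (f p))) \<circ> g \<circ> chart_inv (N (f p))"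
  \<comment> \<open>On this neighbourhood of \<open>p\<close> the middle chart and its inverse
    cancel, so the composed coordinate expressions represent the composed map.\<close>
  let ?U = "f -` chart_dom (N (f p))"
  have U: "open ?U" "p \<in> ?U"
    using assms(3) N(1,2) by (auto intro: open_vimage)
  have "(?G \<circ> ?F has_derivative tangent_map N P g (f p) \<circ> tangent_map M N f p)
          (at (chart_map (M p) p))"
    using diff_at_has_derivative[OF assms(5)] diff_at_has_derivative[OF assms(4)] M(1,6)
    by (intro diff_chain_at) auto
  from tangent_map_unique[OF assms(1) U this, of P "\<lambda>x. g (f x)"] M(6) N(6)
  show "diff_at M P (\<lambda>x. g (f x)) p"
    "tangent_map M P (\<lambda>x. g (f x)) p = tangent_map N P g (f p) \<circ> tangent_map M N f p"
    by auto
qed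

section \<open>Products of a manifold with a vector space\<close>

lemma chart_inv_prod:
  assumes "inj_on (chart_map (M p)) (chart_dom (M p))" "inj_on (chart_map (N q)) (chart_dom (N q))"
    and "x \<in> chart_dom (M p)" "y \<in> chart_dom (N q)"
  shows "chart_inv ((M \<times>\<^sub>M N) (p, q)) (chart_map (M p) x, chart_map (N q) y) = (x, y)"
proof -
  \<comment> \<open>\<open>chart_inv\<close> of a product chart is one \<open>inv_into\<close> of
    the product map; injectivity of that map is what makes it split into components.\<close>
  have "inj_on (map_prod (chart_map (M p)) (chart_map (N q))) (chart_dom (M p) \<times> chart_dom (N q))"
    using assms(1,2) by (rule map_prod_inj_on)
  from inv_into_f_f[OF this, of "(x, y)"] assms(3,4) show ?thesis
    by (simp add: chart_inv_def prod_charts_def)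
qed

text \<open>This merges the three vector factors of \<open>TTG_charts\<close> into one, so that both
  spaces have the form \<open>charts G \<times>\<^sub>M vector_charts\<close>.\<close>

lemma prod_vector_charts: "vector_charts \<times>\<^sub>M vector_charts = vector_charts"
  by (auto simp: prod_charts_def vector_charts_def fun_eq_iff map_prod_def)

lemma continuous_on_map_prod_id:
  assumes "bounded_linear L"
  shows "continuous_on S (map_prod id L)"
  unfolding map_prod_def case_prod_unfold id_def
  by (intro continuous_intros bounded_linear.continuous_on[OF assms])

text \<open>In coordinates the map is a transition function of \<open>M\<close> times
  \<open>J\<close>. At \<open>p\<close> and at its image the same chart of \<open>M\<close> is used,
  so the transition function is the identity there, and the tangent map is the linear map
  itself.\<close>

lemma
  fixes M :: "('p::{t2_space,second_countable_topology}, 'e::real_normed_vector) charts"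
    and J :: "'a::real_normed_vector \<Rightarrow> 'b::real_normed_vector"
  assumes M: "smooth_manifold M" and J: "bounded_linear J"
  shows smooth_map_map_prod_id:
      "smooth_map (M \<times>\<^sub>M vector_charts) (M \<times>\<^sub>M vector_charts) (map_prod id J)" (is ?smooth)
    and tangent_map_map_prod_id:
      "tangent_map (M \<times>\<^sub>M vector_charts) (M \<times>\<^sub>M vector_charts) (map_prod id J) p = map_prod id J"
      (is ?tangent)
proof -
  note D = smooth_manifoldD[OF M]
  have inv: "chart_inv ((M \<times>\<^sub>M vector_charts) (a, b)) (chart_map (M a) x, y) = (x, y)"
    if "x \<in> chart_dom (M a)" for a x and b y :: 'a
    using chart_inv_prod[where M = M and p = a and N = vector_charts and q = b and y = y] D(7) that
    by (simp add: vector_charts_def)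
  have blJ: "bounded_linear (\<lambda>z :: 'e \<times> 'a. (0 :: 'e, J (snd z)))"
    by (intro bounded_linear_Pair bounded_linear_zero bounded_linear_compose[OF J] bounded_linear_snd)
  have blI: "bounded_linear (\<lambda>x :: 'e. (x, 0 :: 'b))"
    by (intro bounded_linear_Pair bounded_linear_zero bounded_linear_ident)
  show ?smooth
    unfolding smooth_map_def smooth_on_def
  proof (intro conjI allI)
    show "continuous_on UNIV (map_prod id J :: 'p \<times> 'a \<Rightarrow> 'p \<times> 'b)"
      using J by (rule continuous_on_map_prod_id)
  next
    fix p :: "'p \<times> 'a" and q :: "'p \<times> 'b" and k
    obtain p1 p2 q1 q2 where pq: "p = (p1, p2)" "q = (q1, q2)"
      by (meson surj_pair)
    let ?S = "chart_map (M p1) ` (chart_dom (M p1) \<inter> chart_dom (M q1))"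
    let ?f = "chart_map (M q1) \<circ> chart_inv (M p1)"
    have S: "open ?S" "open (?S \<times> (UNIV :: 'a set))"
      using open_chart_image[OF M D(2)] by (auto intro: open_Times)
    have set_eq: "chart_map ((M \<times>\<^sub>M vector_charts) p) `
        (chart_dom ((M \<times>\<^sub>M vector_charts) p) \<inter>
          map_prod id J -` chart_dom ((M \<times>\<^sub>M vector_charts) q)) = ?S \<times> UNIV"
      unfolding pq by (force simp: prod_charts_def vector_charts_def)
    have f: "Ck_on k ?S ?f"
      using D(5) unfolding smooth_on_def by blast
    \<comment> \<open>Writing the pair as a sum reduces smoothness to the transition function
      between linear maps plus a purely linear term.\<close>
    have "Ck_on k (?S \<times> UNIV) (\<lambda>z. (?f (fst z), 0) + (0, J (snd z)))"
      by (intro Ck_on_add S bounded_linear_compose_Ck_on[OF blI]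
          Ck_on_compose_bounded_linear[OF bounded_linear_fst _ _ f] Ck_on_bounded_linear[OF blJ]) auto
    then show "Ck_on k (chart_map ((M \<times>\<^sub>M vector_charts) p) `
        (chart_dom ((M \<times>\<^sub>M vector_charts) p) \<inter>
          map_prod id J -` chart_dom ((M \<times>\<^sub>M vector_charts) q)))
        (chart_map ((M \<times>\<^sub>M vector_charts) q) \<circ> map_prod id J \<circ> chart_inv ((M \<times>\<^sub>M vector_charts) p))"
      unfolding set_eq unfolding pq
      by (rule Ck_on_cong[OF S(2), rotated]) (auto simp: inv D(6), auto simp: prod_charts_def vector_charts_def)
  qed
  obtain p1 p2 where p: "p = (p1, p2)"
    by (meson surj_pair)
  have "bounded_linear (map_prod id J :: 'e \<times> 'a \<Rightarrow> 'e \<times> 'b)"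
    unfolding map_prod_def case_prod_unfold id_def
    by (intro bounded_linear_Pair bounded_linear_fst bounded_linear_compose[OF J] bounded_linear_snd)
  then have "(map_prod id J has_derivative map_prod id J) (at (chart_map (M p1) p1, p2))"
    by (rule bounded_linear_imp_has_derivative)
  then have "(chart_map ((M \<times>\<^sub>M vector_charts) (map_prod id J p)) \<circ> map_prod id J \<circ>
      chart_inv ((M \<times>\<^sub>M vector_charts) p) has_derivative map_prod id J) (at (chart_map (M p1) p1, p2))"
    by (rule has_derivative_transform_within_open[where
          s = "chart_map (M p1) ` chart_dom (M p1) \<times> UNIV"])
      (use D(1,4,6) in \<open>auto intro!: open_Times simp: p inv, auto simp: prod_charts_def vector_charts_def\<close>)
  from frechet_derivative_at[OF this] show ?tangent
    unfolding tangent_map_def by (simp add: p prod_charts_def vector_charts_def)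
qed

lemma smooth_embedding_map_prod_id:
  assumes "smooth_manifold M" "bounded_linear J" "bounded_linear K" "\<And>y. K (J y) = y"
  shows "smooth_embedding (M \<times>\<^sub>M vector_charts) (M \<times>\<^sub>M vector_charts) (map_prod id J)"
  unfolding smooth_embedding_def
proof (intro conjI allI)
  have "inj J"
    using assms(4) by (metis injI)
  then show "inj (tangent_map (M \<times>\<^sub>M vector_charts) (M \<times>\<^sub>M vector_charts) (map_prod id J) p)" for p
    using assms(1,2) by (simp add: tangent_map_map_prod_id prod.inj_map)
  \<comment> \<open>The left inverse \<open>K\<close> yields a continuous retraction onto the
    source, and a section of a retraction is a topological embedding.\<close>
  have "retraction_maps euclidean euclidean (map_prod id K) (map_prod id J)"
    unfolding retraction_maps_def using assms(2-4) by (auto simp: continuous_on_map_prod_id)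
  then show "embedding_map euclidean euclidean (map_prod id J)"
    by (meson section_imp_embedding_map section_map_def)
qed (rule smooth_map_map_prod_id[OF assms(1,2)])

section \<open>Lie groups\<close>

locale lie =
  fixes G :: "('g::{t2_space,second_countable_topology}, 'e::real_normed_vector) lie_structure"
    (structure)
  assumes lie: "lie_group G"
begin

lemma grp: "group G" and car [simp]: "carrier G = UNIV" and man: "smooth_manifold (charts G)"
  and smooth_mult: "smooth_map (charts G \<times>\<^sub>M charts G) (charts G) (\<lambda>(g, h). g \<otimes> h)"
  using lie unfolding lie_group_def by blast+

sublocale group G
  by (rule grp)

section \<open>Left and right translations and their tangent maps\<close>

lemma continuous_mult: "continuous_on UNIV (\<lambda>(g, h). g \<otimes> h)"
  using smooth_mult unfolding smooth_map_def by blast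

lemma continuous_mult_left: "continuous_on UNIV (\<lambda>h. g \<otimes> h)"
  and continuous_mult_right: "continuous_on UNIV (\<lambda>h. h \<otimes> g)"
  using continuous_on_compose2[OF continuous_mult continuous_on_Pair[OF continuous_on_const continuous_on_id]]
    continuous_on_compose2[OF continuous_mult continuous_on_Pair[OF continuous_on_id continuous_on_const]]
  by simp_all

lemma mult_has_derivative:
  obtains F' where
    "(chart_map (charts G (g \<otimes> h)) \<circ> (\<lambda>(g, h). g \<otimes> h) \<circ> chart_inv ((charts G \<times>\<^sub>M charts G) (g, h))
      has_derivative F') (at (chart_map (charts G g) g, chart_map (charts G h) h))"
proof -
  have "diff_at (charts G \<times>\<^sub>M charts G) (charts G) (\<lambda>(g, h). g \<otimes> h) (g, h)"
    by (rule smooth_map_imp_diff_at[OF smooth_mult])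
      (auto simp: prod_charts_def smooth_manifoldD(1)[OF man])
  from diff_at_has_derivative[OF this] that show ?thesis
    by (auto simp: prod_charts_def)
qed

lemma diff_at_mult_left: "diff_at (charts G) (charts G) (\<lambda>h. g \<otimes> h) h"
proof -
  note D = smooth_manifoldD[OF man]
  obtain F' where F': "(chart_map (charts G (g \<otimes> h)) \<circ> (\<lambda>(g, h). g \<otimes> h) \<circ>
      chart_inv ((charts G \<times>\<^sub>M charts G) (g, h)) has_derivative F')
      (at (chart_map (charts G g) g, chart_map (charts G h) h))" (is "(?F has_derivative _) _")
    by (rule mult_has_derivative)
  \<comment> \<open>Left translation is multiplication restricted to the slice with first factor
    \<open>g\<close>; in coordinates the slice is affine and the chain rule applies.\<close>
  have "((\<lambda>x. (chart_map (charts G g) g, x)) has_derivative (\<lambda>v. (0, v))) (at (chart_map (charts G h) h))"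
    by (intro has_derivative_Pair has_derivative_const has_derivative_ident)
  from diff_chain_at[OF this F'] show ?thesis
    by (rule tangent_map_unique(1)[OF man open_UNIV UNIV_I])
      (simp add: chart_inv_prod D)
qed

lemma diff_at_mult_right: "diff_at (charts G) (charts G) (\<lambda>h. h \<otimes> g) h"
proof -
  note D = smooth_manifoldD[OF man]
  obtain F' where F': "(chart_map (charts G (h \<otimes> g)) \<circ> (\<lambda>(g, h). g \<otimes> h) \<circ>
      chart_inv ((charts G \<times>\<^sub>M charts G) (h, g)) has_derivative F')
      (at (chart_map (charts G h) h, chart_map (charts G g) g))" (is "(?F has_derivative _) _")
    by (rule mult_has_derivative)
  have "((\<lambda>x. (x, chart_map (charts G g) g)) has_derivative (\<lambda>v. (v, 0))) (at (chart_map (charts G h) h))"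
    by (intro has_derivative_Pair has_derivative_const has_derivative_ident)
  from diff_chain_at[OF this F'] show ?thesis
    by (rule tangent_map_unique(1)[OF man open_UNIV UNIV_I])
      (simp add: chart_inv_prod D)
qed

text \<open>Right translations by \<open>g\<close> and \<open>inv g\<close> are mutually inverse, so
  by functoriality their tangent maps are too. The second is taken at \<open>g\<close>, the image of
  the identity under the first.\<close>

lemma bij_T_R: "bij (T_R G g)"
proof -
  let ?S = "tangent_map (charts G) (charts G) (\<lambda>h. h \<otimes> inv g) g"
  note c = tangent_map_compose(2)[OF man man continuous_mult_right diff_at_mult_right diff_at_mult_right]
  have "?S \<circ> T_R G g = id"
    using c[of g "inv g" \<one>] by (simp add: T_R_def m_assoc tangent_map_id[OF man])
  moreover have "T_R G g \<circ> ?S = id"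
    using c[of "inv g" g g] by (simp add: T_R_def m_assoc tangent_map_id[OF man])
  ultimately show ?thesis
    by (rule o_bij)
qed

text \<open>Conjugation is a left translation followed by a right one, hence differentiable at the
  identity. Linearity makes \<open>Ad G g\<close> vanish at zero.\<close>

lemma linear_Ad: "linear (Ad G g)"
  unfolding Ad_def
  using tangent_map_compose(1)[OF man man continuous_mult_left[of "inv g"] diff_at_mult_left
      diff_at_mult_right[of g], of \<one>]
  by (rule linear_tangent_map)

text \<open>For a zero left argument the curve to be differentiated is constant; for a zero right
  argument, treated next, it is constantly zero.\<close>

lemma bracket_zero_left [simp]: "bracket G 0 \<eta> = 0"
  by (simp add: bracket_def)

lemma bracket_zero_right [simp]: "bracket G \<xi> 0 = 0"
  by (simp add: bracket_def linear_0[OF linear_Ad])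

lemma ad_star_zero_left [simp]: "ad_star G 0 \<mu> = 0"
  and ad_star_zero_right [simp]: "ad_star G \<xi> 0 = 0"
proof -
  have "Blinfun (\<lambda>\<eta>. 0) = (0 :: 'e dual)"
    by (rule zero_blinfun.abs_eq[symmetric])
  then show "ad_star G 0 \<mu> = 0" "ad_star G \<xi> 0 = 0"
    by (simp_all add: ad_star_def)
qed

lemma T_R_eq_iff [simp]: "T_R G g \<xi> = T_R G g \<eta> \<longleftrightarrow> \<xi> = \<eta>"
  using bij_T_R by (metis bij_def inj_eq)

section \<open>The trivialising fields and evaluation of the forms\<close>

lemma GS_field_eq_iff [simp]: "GS_field G a p = GS_field G b p \<longleftrightarrow> a = b"
  by (cases a; cases b; cases p) (auto simp: GS_field_def)

text \<open>The field is triangular in its coefficients: injectivity of \<open>T_R G g\<close>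
  recovers the first, and each later one is then isolated by cancelling terms already known.
  Uniqueness of the coefficients makes the definite description in \<open>TTG_form\<close> well
  defined.\<close>

lemma TTG_field_eq_iff [simp]: "TTG_field G a p = TTG_field G b p \<longleftrightarrow> a = b"
  by (cases a; cases b; cases p) (auto simp: TTG_field_def)

lemma GS_form_field:
  "GS_form G (g, \<mu>) (GS_field G (\<xi>, \<nu>) (g, \<mu>)) (GS_field G (\<eta>, \<kappa>) (g, \<mu>)) =
     blinfun_apply \<nu> \<eta> - blinfun_apply \<kappa> \<xi> + blinfun_apply \<mu> (bracket G \<xi> \<eta>)"
  by (simp add: GS_form_def)

lemma TTG_form_field:
  "TTG_form G (g, \<mu>, \<xi>, \<nu>) (TTG_field G (\<xi>\<^sub>2, \<nu>\<^sub>2, \<xi>\<^sub>3, \<nu>\<^sub>3) (g, \<mu>, \<xi>, \<nu>))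
       (TTG_field G (\<eta>\<^sub>2, \<kappa>\<^sub>2, \<eta>\<^sub>3, \<kappa>\<^sub>3) (g, \<mu>, \<xi>, \<nu>)) =
     blinfun_apply \<nu>\<^sub>3 \<eta>\<^sub>2 + blinfun_apply \<nu>\<^sub>2 \<eta>\<^sub>3
         - blinfun_apply \<kappa>\<^sub>2 \<xi>\<^sub>3 - blinfun_apply \<kappa>\<^sub>3 \<xi>\<^sub>2
         + blinfun_apply \<nu> (bracket G \<xi>\<^sub>2 \<eta>\<^sub>2)
         + blinfun_apply \<mu> (bracket G \<xi>\<^sub>3 \<eta>\<^sub>2 + bracket G \<xi>\<^sub>2 \<eta>\<^sub>3
             + bracket G \<xi> (bracket G \<xi>\<^sub>2 \<eta>\<^sub>2))"
  by (simp add: TTG_form_def)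

text \<open>Surjectivity of \<open>T_R G g\<close> gives \<xi>; subtracting the coadjoint term then
  gives \<nu>.\<close>

lemma GS_field_surj:
  obtains \<xi> \<nu> where "v = GS_field G (\<xi>, \<nu>) (g, \<mu>)"
proof -
  obtain \<xi> where "fst v = T_R G g \<xi>"
    using bij_T_R by (metis bij_pointE)
  then have "v = GS_field G (\<xi>, snd v - ad_star G \<xi> \<mu>) (g, \<mu>)"
    by (simp add: GS_field_def prod_eq_iff)
  then show ?thesis
    by (rule that)
qed

text \<open>At a base point with last two entries zero, every correction term in the last two
  components has a zero argument. The coefficients of an embedded vector are therefore those in the
  source, padded by zeros.\<close>

lemma TTG_field_Emb\<^sub>1:
  "TTG_field G (\<xi>, \<nu>, 0, 0) (g, \<mu>, 0, 0) = (fst v, snd v, 0, 0)"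
  if "v = GS_field G (\<xi>, \<nu>) (g, \<mu>)"
  using that by (simp add: TTG_field_def GS_field_def)

lemma TTG_field_Emb\<^sub>2:
  "TTG_field G (\<xi>, 0, 0, \<kappa>) (g, 0, 0, \<nu>) = (fst v, 0, 0, snd v)"
  if "v = GS_field G (\<xi>, \<kappa>) (g, \<nu>)"
  using that by (simp add: TTG_field_def GS_field_def)

text \<open>Isotropy: each plain pairing contains a zero last coefficient or the zero base entry,
  and each bracket paired with \<mu> has a zero argument.\<close>

lemma TTG_form_Emb\<^sub>1: "TTG_form G (g, \<mu>, 0, 0) (fst v, snd v, 0, 0) (fst w, snd w, 0, 0) = 0"
proof -
  obtain \<xi> \<nu> where v: "v = GS_field G (\<xi>, \<nu>) (g, \<mu>)"
    by (rule GS_field_surj)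
  obtain \<eta> \<kappa> where w: "w = GS_field G (\<eta>, \<kappa>) (g, \<mu>)"
    by (rule GS_field_surj)
  show ?thesis
    using TTG_form_field[of g \<mu> 0 0 \<xi> \<nu> 0 0 \<eta> \<kappa> 0 0] TTG_field_Emb\<^sub>1[OF v] TTG_field_Emb\<^sub>1[OF w]
    by simp
qed

text \<open>The zero middle coefficients and base entries leave the pairings of \<kappa> with \<eta>
  and of \<tau> with \<xi>, and the bracket term at \<nu>, which form the canonical
  expression.\<close>

lemma TTG_form_Emb\<^sub>2:
  "TTG_form G (g, 0, 0, \<nu>) (fst v, 0, 0, snd v) (fst w, 0, 0, snd w) = GS_form G (g, \<nu>) v w"
proof -
  obtain \<xi> \<kappa> where v: "v = GS_field G (\<xi>, \<kappa>) (g, \<nu>)"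
    by (rule GS_field_surj)
  obtain \<eta> \<tau> where w: "w = GS_field G (\<eta>, \<tau>) (g, \<nu>)"
    by (rule GS_field_surj)
  have "GS_form G (g, \<nu>) v w =
      blinfun_apply \<kappa> \<eta> - blinfun_apply \<tau> \<xi> + blinfun_apply \<nu> (bracket G \<xi> \<eta>)"
    unfolding v w by (rule GS_form_field)
  then show ?thesis
    using TTG_form_field[of g 0 0 \<nu> \<xi> 0 0 \<kappa> \<eta> 0 0 \<tau>] TTG_field_Emb\<^sub>2[OF v] TTG_field_Emb\<^sub>2[OF w]
    by simp
qed

end

section \<open>Embeddings\<close>

text \<open>In infinite dimension both sides are the junk value 0 of \<^const>\<open>dim\<close>.\<close>

lemma dim_UNIV_direct_sum:
  fixes f h :: "'a::real_vector \<Rightarrow> 'b::real_vector" and p q :: "'b \<Rightarrow> 'a"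
  assumes lin: "linear f" "linear h" "linear p" "linear q"
    and pf: "\<And>x. p (f x) = x" and qh: "\<And>x. q (h x) = x"
    and ph: "\<And>x. p (h x) = 0" and qf: "\<And>x. q (f x) = 0"
    and sum: "\<And>y. f (p y) + h (q y) = y"
  shows "dim (UNIV :: 'b set) = 2 * dim (range f)"
proof -
  obtain B :: "'a set" where B: "independent B" "span B = UNIV"
    by (rule maximal_independent_subset[of "UNIV :: 'a set"]) auto
  have inj: "inj f" "inj h"
    by (metis pf injI) (metis qh injI)
  have span: "span (f ` B) = range f" "span (h ` B) = range h"
    by (simp_all only: linear_span_image[OF lin(1)] linear_span_image[OF lin(2)] B(2))
  have ind: "independent (f ` B)"
    using lin(1) B(1) inj_on_subset[OF inj(1) subset_UNIV] by (rule linear_independent_injective_image)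
  have "f a \<noteq> h b" if "a \<in> B" for a b
  proof
    assume "f a = h b"
    then have "a = 0"
      using pf[of a] ph[of b] by simp
    then show False
      using that B(1) dependent_zero by blast
  qed
  then have disj: "f ` B \<inter> h ` B = {}"
    by auto
  \<comment> \<open>The projection \<open>l\<close> undoes \<open>r\<close> and kills
    \<open>s\<close>. A dependence of \<open>r b\<close> on the other vectors would project to a
    dependence of \<open>b\<close> on the rest of \<open>B\<close>. Stated for general
    \<open>r\<close> and \<open>s\<close>, it serves both halves of the union.\<close>
  have not_span: "r b \<notin> span (r ` B \<union> s ` B - {r b})"
    if "b \<in> B" and l: "linear l" and r: "\<And>x. l (r x) = x" and s: "\<And>x. l (s x) = (0 :: 'a)"
    for b and r s :: "'a \<Rightarrow> 'b" and l
  proof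
    assume "r b \<in> span (r ` B \<union> s ` B - {r b})"
    then have "l (r b) \<in> l ` span (r ` B \<union> s ` B - {r b})"
      by (rule imageI)
    then have "b \<in> span (l ` (r ` B \<union> s ` B - {r b}))"
      by (simp only: linear_span_image[OF l] r)
    moreover have "l ` (r ` B \<union> s ` B - {r b}) \<subseteq> insert 0 (B - {b})"
      by (auto simp: r s)
    ultimately have "b \<in> span (insert 0 (B - {b}))"
      using span_mono by blast
    then show False
      using B(1) that(1) by (auto simp: dependent_def)
  qed
  have "independent (f ` B \<union> h ` B)"
  proof -
    have "y \<notin> span (f ` B \<union> h ` B - {y})" if "y \<in> f ` B \<union> h ` B" for y
      using that
    proof
      assume "y \<in> f ` B"
      then show ?thesis
        using not_span[where r = f and s = h, OF _ lin(3) pf ph] by blast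
    next
      assume "y \<in> h ` B"
      then show ?thesis
        using not_span[where r = h and s = f, OF _ lin(4) qh qf] by (auto simp: Un_commute)
    qed
    then show ?thesis
      unfolding dependent_def by blast
  qed
  moreover have "span (f ` B \<union> h ` B) = UNIV"
  proof -
    have "y \<in> span (f ` B \<union> h ` B)" for y
    proof -
      have "f (p y) + h (q y) \<in> span (f ` B \<union> h ` B)"
        unfolding span_Un span by blast
      then show ?thesis
        by (simp only: sum)
    qed
    then show ?thesis
      by blast
  qed
  ultimately have "dim (UNIV :: 'b set) = card (f ` B \<union> h ` B)"
    by (intro dim_eq_card) (simp_all only: span_UNIV not_False_eq_True)
  also have "\<dots> = 2 * card B"
  \<comment> \<open>For infinite \<open>B\<close> both cardinals are 0, so the identity still
    holds.\<close>
  proof (cases "finite B")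
    case True
    then show ?thesis
      using disj inj by (simp add: card_Un_disjoint card_image inj_on_subset[OF _ subset_UNIV])
  next
    case False
    then have "infinite (f ` B)"
      using inj_on_subset[OF inj(1) subset_UNIV] by (simp add: finite_image_iff)
    with False show ?thesis
      by simp
  qed
  also have "card B = card (f ` B)"
    using inj(1) by (simp add: card_image inj_on_subset[OF _ subset_UNIV])
  also have "\<dots> = dim (span (f ` B))"
    by (simp only: dim_span dim_eq_card_independent[OF ind])
  finally have "dim (UNIV :: 'b set) = 2 * dim (span (f ` B))" .
  then show ?thesis
    by (simp only: span)
qed

theorem mainTheorem18:
  fixes G :: "('g::{t2_space,second_countable_topology}, 'e::real_normed_vector) lie_structure"
  assumes "lie_group G"
  shows "lagrangian_embedding (GS_charts G) (TTG_charts G) (TTG_form G) Emb\<^sub>1 \<and>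
         symplectic_embedding (GS_charts G) (GS_form G) (TTG_charts G) (TTG_form G) Emb\<^sub>2"
proof -
  interpret lie G
    by unfold_locales (rule assms)
  let ?J\<^sub>1 = "\<lambda>\<mu>. (\<mu>, 0, 0) :: 'e dual \<times> 'e \<times> 'e dual"
  let ?J\<^sub>2 = "\<lambda>\<nu>. (0, 0, \<nu>) :: 'e dual \<times> 'e \<times> 'e dual"
  have Emb: "Emb\<^sub>1 = (map_prod id ?J\<^sub>1 :: 'g \<times> _ \<Rightarrow> _)" "Emb\<^sub>2 = (map_prod id ?J\<^sub>2 :: 'g \<times> _ \<Rightarrow> _)"
    by (auto simp: Emb\<^sub>1_def Emb\<^sub>2_def)
  have charts: "TTG_charts G = charts G \<times>\<^sub>M vector_charts"
    by (simp add: TTG_charts_def prod_vector_charts)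
  have J: "bounded_linear ?J\<^sub>1" "bounded_linear ?J\<^sub>2"
    by (intro bounded_linear_Pair bounded_linear_zero bounded_linear_ident)+
  have emb: "smooth_embedding (GS_charts G) (TTG_charts G) Emb\<^sub>1"
    "smooth_embedding (GS_charts G) (TTG_charts G) Emb\<^sub>2"
    unfolding Emb charts GS_charts_def
    \<comment> \<open>The left inverses of the two inclusions are the projections to the first and
      to the last vector factor.\<close>
    by (rule smooth_embedding_map_prod_id[OF man J(1) bounded_linear_fst], simp)
      (rule smooth_embedding_map_prod_id[OF man J(2)
          bounded_linear_compose[OF bounded_linear_snd bounded_linear_snd]], simp)
  have tangent: "tangent_map (GS_charts G) (TTG_charts G) Emb\<^sub>1 p = map_prod id ?J\<^sub>1"
    "tangent_map (GS_charts G) (TTG_charts G) Emb\<^sub>2 p = map_prod id ?J\<^sub>2" for p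
    unfolding Emb charts GS_charts_def by (rule tangent_map_map_prod_id[OF man] J)+
  have lin: "linear (map_prod id ?J\<^sub>1 :: 'e \<times> 'e dual \<Rightarrow> _)"
    by (rule linearI) auto
  \<comment> \<open>The image consists of the first two factors. The last two form a complement that
    is another copy of the same space, so the image has half the dimension.\<close>
  have "dim (UNIV :: ('e \<times> 'e dual \<times> 'e \<times> 'e dual) set) =
      2 * dim (range (map_prod id ?J\<^sub>1 :: 'e \<times> 'e dual \<Rightarrow> _))"
    by (rule dim_UNIV_direct_sum[OF lin, where h = "\<lambda>(v, w). (0, 0, v, w)"
          and p = "\<lambda>(a, b, c, d). (a, b)" and q = "\<lambda>(a, b, c, d). (c, d)"])
      (auto intro!: linearI simp: zero_prod_def)
  then have "lagrangian_subspace (TTG_form G (Emb\<^sub>1 p))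
      (range (tangent_map (GS_charts G) (TTG_charts G) Emb\<^sub>1 p))" for p
    using TTG_form_Emb\<^sub>1[of "fst p" "snd p"] linear_subspace_image[OF lin subspace_UNIV]
    unfolding lagrangian_subspace_def tangent by (auto simp: Emb\<^sub>1_def case_prod_unfold map_prod_def)
  moreover have "pullback_form (GS_charts G) (TTG_charts G) Emb\<^sub>2 (TTG_form G) = GS_form G"
    unfolding pullback_form_def tangent
    using TTG_form_Emb\<^sub>2 by (auto simp: fun_eq_iff Emb\<^sub>2_def map_prod_def case_prod_unfold)
  ultimately show ?thesis
    using emb unfolding lagrangian_embedding_def symplectic_embedding_def by blast
qed

end
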